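(* Each additive metric $\rho$ on a finite set $M$ is boundary rigid.
   Context: A finite graph $G=(V,E)$ joins $M$ if it is connected and $M\subset V$. A weighted tree $(G,\omega)$ is a tree with a weight function $\omega:E\to[0,\infty)$; it is non-degenerate if $\omega(e)>0$ for all edges $e$. For a weighted graph, $d_\omega(u,v)$ is the least weight (sum of $\omega$ over edges) of a path in $G$ joining $u$ and $v$, and $\omega(G)=\sum_{e\in E}\omega(e)$. The weighted graph $(G,\omega)$ is a filling of $(M,\rho)$ if $G$ joins $M$ and $\rho(p,q)\le d_\omega(p,q)$ for all $p,q\in M$. A minimal filling is a filling whose weight $\omega(G)$ is least among all fillings of $(M,\rho)$ (over all connected graphs $G$ joining $M$). Convention: all trees considered are such that all their vertices of degree $1$ and $2$ belong to $M$. A metric $\rho$ on $M$ is additive if there exists a weighted tree $(G,\omega)$ joining $M$ such that $\rho$ coincides with the restriction of $d_\omega$ to $M$. A pseudo-metric $\rho$ on a finite set $M$ is boundary rigid if the minimal filling of $(M,\rho)$ is unique in the class of non-degenerate trees, where weighted trees are considered up to an isomorphism of weighted graphs which is the identity on $M$. *)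

theory Defs
  imports "HOL-Analysis.Abstract_Metric_Spaces" "HOL-Library.Infinite_Typeclass"
begin

text \<open>
  Weighted graphs are undirected and simple. Edges are two-element vertex sets, and only the
  values of \<open>weight\<close> on edges matter.
\<close>

record 'a wgraph =
  verts :: "'a set"
  edges :: "'a set set"
  weight :: "'a set \<Rightarrow> real"

definition weighted_graph :: "'a wgraph \<Rightarrow> bool" where
  "weighted_graph G \<longleftrightarrow>
     finite (verts G) \<and> verts G \<noteq> {} \<and>
     edges G \<subseteq> {{u, v} | u v. u \<in> verts G \<and> v \<in> verts G \<and> u \<noteq> v} \<and>
     (\<forall>e \<in> edges G. 0 \<le> weight G e)"

definition graph_path :: "'a wgraph \<Rightarrow> 'a \<Rightarrow> 'a \<Rightarrow> 'a list \<Rightarrow> bool" where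
  "graph_path G u v xs \<longleftrightarrow>
     xs \<noteq> [] \<and> hd xs = u \<and> last xs = v \<and> set xs \<subseteq> verts G \<and> distinct xs \<and>
     successively (\<lambda>x y. {x, y} \<in> edges G) xs"

definition path_weight :: "'a wgraph \<Rightarrow> 'a list \<Rightarrow> real" where
  "path_weight G xs = (\<Sum>(x, y) \<leftarrow> zip xs (tl xs). weight G {x, y})"

definition graph_dist :: "'a wgraph \<Rightarrow> 'a \<Rightarrow> 'a \<Rightarrow> real" where
  "graph_dist G u v = Min {path_weight G xs | xs. graph_path G u v xs}"

definition total_weight :: "'a wgraph \<Rightarrow> real" where
  "total_weight G = (\<Sum>e \<in> edges G. weight G e)"

definition connected_graph :: "'a wgraph \<Rightarrow> bool" where
  "connected_graph G \<longleftrightarrow> (\<forall>u \<in> verts G. \<forall>v \<in> verts G. \<exists>xs. graph_path G u v xs)"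

definition graph_cycle :: "'a wgraph \<Rightarrow> 'a list \<Rightarrow> bool" where
  "graph_cycle G xs \<longleftrightarrow>
     3 \<le> length xs \<and> set xs \<subseteq> verts G \<and> distinct xs \<and>
     successively (\<lambda>x y. {x, y} \<in> edges G) xs \<and> {last xs, hd xs} \<in> edges G"

definition vertex_degree :: "'a wgraph \<Rightarrow> 'a \<Rightarrow> nat" where
  "vertex_degree G v = card {e \<in> edges G. v \<in> e}"

definition joins :: "'a wgraph \<Rightarrow> 'a set \<Rightarrow> bool" where
  "joins G M \<longleftrightarrow> weighted_graph G \<and> connected_graph G \<and> M \<subseteq> verts G"

text \<open>
  The last conjunct is the standing convention on trees: every vertex of degree 1 or 2
  belongs to \<open>M\<close>. Zero weights are still allowed here.
\<close>

definition tree_joining :: "'a wgraph \<Rightarrow> 'a set \<Rightarrow> bool" where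
  "tree_joining G M \<longleftrightarrow>
     joins G M \<and> (\<nexists>xs. graph_cycle G xs) \<and>
     (\<forall>v \<in> verts G. vertex_degree G v \<in> {1, 2} \<longrightarrow> v \<in> M)"

definition nondegenerate :: "'a wgraph \<Rightarrow> bool" where
  "nondegenerate G \<longleftrightarrow> (\<forall>e \<in> edges G. 0 < weight G e)"

definition filling :: "'a set \<Rightarrow> ('a \<Rightarrow> 'a \<Rightarrow> real) \<Rightarrow> 'a wgraph \<Rightarrow> bool" where
  "filling M \<rho> G \<longleftrightarrow> joins G M \<and> (\<forall>p \<in> M. \<forall>q \<in> M. \<rho> p q \<le> graph_dist G p q)"

text \<open>
  From here on, graphs are quantified over. The type \<open>'a\<close> plays the role of the universe from
  which both the points of \<open>M\<close> and the additional vertices are drawn. It is required to be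
  infinite so that it contains, up to an isomorphism fixing \<open>M\<close>, every finite graph whose
  vertex set includes the finite set \<open>M\<close>.
\<close>

definition minimal_filling ::
    "'a::infinite set \<Rightarrow> ('a \<Rightarrow> 'a \<Rightarrow> real) \<Rightarrow> 'a wgraph \<Rightarrow> bool" where
  "minimal_filling M \<rho> G \<longleftrightarrow>
     filling M \<rho> G \<and> (\<forall>H. filling M \<rho> H \<longrightarrow> total_weight G \<le> total_weight H)"

definition additive_on :: "'a::infinite set \<Rightarrow> ('a \<Rightarrow> 'a \<Rightarrow> real) \<Rightarrow> bool" where
  "additive_on M \<rho> \<longleftrightarrow>
     (\<exists>G. tree_joining G M \<and> (\<forall>p \<in> M. \<forall>q \<in> M. \<rho> p q = graph_dist G p q))"

definition isomorphic_over :: "'a set \<Rightarrow> 'a wgraph \<Rightarrow> 'a wgraph \<Rightarrow> bool" where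
  "isomorphic_over M G H \<longleftrightarrow>
     (\<exists>f. bij_betw f (verts G) (verts H) \<and>
          (\<lambda>e. f ` e) ` edges G = edges H \<and>
          (\<forall>e \<in> edges G. weight H (f ` e) = weight G e) \<and>
          (\<forall>p \<in> M. f p = p))"

definition pseudo_metric_on :: "'a set \<Rightarrow> ('a \<Rightarrow> 'a \<Rightarrow> real) \<Rightarrow> bool" where
  "pseudo_metric_on M \<rho> \<longleftrightarrow>
     (\<forall>p \<in> M. \<rho> p p = 0) \<and>
     (\<forall>p \<in> M. \<forall>q \<in> M. 0 \<le> \<rho> p q \<and> \<rho> p q = \<rho> q p) \<and>
     (\<forall>p \<in> M. \<forall>q \<in> M. \<forall>r \<in> M. \<rho> p r \<le> \<rho> p q + \<rho> q r)"

text \<open>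
  Uniqueness comprises existence. The competitors in \<^const>\<open>minimal_filling\<close> are all connected
  graphs; only the minimisers being compared are restricted to non-degenerate trees.
\<close>

definition nondegenerate_minimal_tree ::
    "'a::infinite set \<Rightarrow> ('a \<Rightarrow> 'a \<Rightarrow> real) \<Rightarrow> 'a wgraph \<Rightarrow> bool" where
  "nondegenerate_minimal_tree M \<rho> G \<longleftrightarrow>
     tree_joining G M \<and> nondegenerate G \<and> minimal_filling M \<rho> G"

definition boundary_rigid :: "'a::infinite set \<Rightarrow> ('a \<Rightarrow> 'a \<Rightarrow> real) \<Rightarrow> bool" where
  "boundary_rigid M \<rho> \<longleftrightarrow>
     finite M \<and> pseudo_metric_on M \<rho> \<and>
     (\<exists>G. nondegenerate_minimal_tree M \<rho> G) \<and>
     (\<forall>G H. nondegenerate_minimal_tree M \<rho> G \<longrightarrow> nondegenerate_minimal_tree M \<rho> H \<longrightarrow>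
            isomorphic_over M G H)"

end

theory Submission
  imports Defs
begin

text \<open>
  Let \<open>(G, \<omega>)\<close> be a tree whose path metric restricts to \<open>\<rho>\<close> on \<open>M\<close>.

  Every filling \<open>H\<close> of \<open>\<rho>\<close> has at least the weight of \<open>G\<close>. Given \<open>p, q \<in> M\<close>, follow a
  shortest path of \<open>H\<close> from \<open>q\<close> to \<open>p\<close> and visit the other vertices by detours that use new
  edges there and back; the walk has length at most \<open>2 \<omega>(H) - d\<^sub>H(q, p)\<close>
  (\<open>spanning_walk\<close>). Its visits to \<open>M\<close>, closed up by the step from \<open>p\<close> to \<open>q\<close>, form a tour
  of \<open>\<rho>\<close>-length at most \<open>2 \<omega>(H) - (d\<^sub>H(q, p) - \<rho>(q, p))\<close> (\<open>filling_tour\<close>). In \<open>G\<close> a closed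
  tour through \<open>M\<close> crosses each edge at least twice, since all leaves of \<open>G\<close> are in \<open>M\<close>, so that
  its length is at least \<open>2 \<omega>(G)\<close> (\<open>tour_lower_bound\<close>). Hence
  \<open>2 \<omega>(G) + (d\<^sub>H(q, p) - \<rho>(q, p)) \<le> 2 \<omega>(H)\<close>. This shows that \<open>G\<close> is minimal, and also
  that \<open>d\<^sub>H = \<rho>\<close> on \<open>M\<close> for every other minimal filling \<open>H\<close>, as \<open>p\<close> and \<open>q\<close> are arbitrary.

  Existence of a non-degenerate minimal tree follows by contracting the edges of weight zero of
  \<open>G\<close>; no two points of \<open>M\<close> are identified because \<open>\<rho>\<close> is a metric
  (\<open>nondegenerate_contraction\<close>).

  For uniqueness it remains to see that a non-degenerate tree is determined by its metric on \<open>M\<close>.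
  A vertex outside \<open>M\<close> has degree at least three, so it is the median of three points of
  \<open>M\<close>, and its distances to \<open>M\<close> are a formula in \<open>\<rho>\<close> alone. Two trees with the same metric on
  \<open>M\<close> therefore have the same medians. Distances between vertices are recovered from distances
  to \<open>M\<close> by prolonging paths, and edges are the pairs of vertices with nothing in between
  (\<open>isomorphic_over_if_same_dist\<close>).

  Trees are handled through the bipartitions of the vertex set that their edges induce: the
  path metric is a weighted sum over the edges that separate two vertices, and betweenness
  is a condition on each edge separately.
\<close>

section \<open>Walks as vertex lists\<close>

text \<open>
  The length of the walk \<open>xs\<close> when the step from \<open>x\<close> to \<open>y\<close> costs \<open>f x y\<close>; lists with at most one
  vertex have length \<open>0\<close>.
\<close>

definition list_length :: "('a \<Rightarrow> 'a \<Rightarrow> real) \<Rightarrow> 'a list \<Rightarrow> real" where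
  "list_length f xs = (\<Sum>(x, y) \<leftarrow> zip xs (tl xs). f x y)"

lemma list_length_simps [simp]:
  "list_length f [] = 0"
  "list_length f [x] = 0"
  "list_length f (x # y # zs) = f x y + list_length f (y # zs)"
  by (simp_all add: list_length_def)

lemma path_weight_eq_list_length:
  "path_weight G xs = list_length (\<lambda>x y. weight G {x, y}) xs"
  by (simp add: path_weight_def list_length_def)

lemma list_length_append:
  "list_length f (as @ x # bs) = list_length f (as @ [x]) + list_length f (x # bs)"
proof (induction as)
  case (Cons a as)
  then show ?case by (cases as) auto
qed simp

lemma list_length_mono:
  assumes "\<And>x y. x \<in> set xs \<Longrightarrow> y \<in> set xs \<Longrightarrow> f x y \<le> g x y"
  shows "list_length f xs \<le> list_length g xs"
  using assms
proof (induction xs rule: induct_list012)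
  case (3 x y zs)
  have "list_length f (y # zs) \<le> list_length g (y # zs)"
    using 3 by auto
  moreover have "f x y \<le> g x y" using 3(3) by auto
  ultimately show ?case by simp
qed auto

lemma list_length_mono_successively:
  assumes "successively R xs" "\<And>x y. R x y \<Longrightarrow> f x y \<le> g x y"
  shows "list_length f xs \<le> list_length g xs"
  using assms by (induction xs rule: induct_list012) (auto simp: add_mono)

lemma list_length_sum:
  "list_length (\<lambda>x y. \<Sum>e\<in>A. f e x y) xs = (\<Sum>e\<in>A. list_length (f e) xs)"
  by (induction xs rule: induct_list012) (auto simp: sum.distrib)

lemma list_length_mult:
  "list_length (\<lambda>x y. c * f x y) xs = c * list_length f xs"
  by (induction xs rule: induct_list012) (auto simp: algebra_simps)

lemma triangle_le_list_length:
  assumes "xs \<noteq> []" "set xs \<subseteq> V"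
    and "\<And>x. x \<in> V \<Longrightarrow> f x x \<le> 0"
    and "\<And>x y z. x \<in> V \<Longrightarrow> y \<in> V \<Longrightarrow> z \<in> V \<Longrightarrow> f x z \<le> f x y + f y z"
  shows "f (hd xs) (last xs) \<le> list_length f xs"
  using assms(1,2)
proof (induction xs rule: induct_list012)
  case (3 x y zs)
  have "f x (last (y # zs)) \<le> f x y + f y (last (y # zs))"
    using 3(4) last_in_set[of "y # zs"] by (intro assms(4)) auto
  with 3 show ?case by auto
qed (use assms(3) in auto)

text \<open>
  Omitting vertices, other than the first, does not make a walk longer when the costs are
  nonnegative and satisfy the triangle inequality.
\<close>

lemma list_length_filter_le:
  assumes "set (x # xs) \<subseteq> V"
    and nonneg: "\<And>x y. x \<in> V \<Longrightarrow> y \<in> V \<Longrightarrow> 0 \<le> f x y"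
    and tri: "\<And>x y z. x \<in> V \<Longrightarrow> y \<in> V \<Longrightarrow> z \<in> V \<Longrightarrow> f x z \<le> f x y + f y z"
  shows "list_length f (x # filter P xs) \<le> list_length f (x # xs)"
  using assms(1)
proof (induction xs arbitrary: x)
  case (Cons y ys)
  show ?case
  proof (cases "P y")
    case True
    then show ?thesis using Cons by auto
  next
    case False
    have "list_length f (x # filter P ys) \<le> list_length f (x # ys)"
      using Cons by auto
    also have "\<dots> \<le> list_length f (x # y # ys)"
    proof (cases ys)
      case Nil
      then show ?thesis using Cons.prems nonneg by simp
    next
      case (Cons z zs)
      then show ?thesis using Cons.prems tri[of x y z] by simp
    qed
    finally show ?thesis using False by simp
  qed
qed simp

lemma successively_append_Cons:
  "successively R (as @ x # bs) \<longleftrightarrow> successively R (as @ [x]) \<and> successively R (x # bs)"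
proof (induction as)
  case (Cons a as)
  then show ?case by (cases as) auto
qed simp

text \<open>
  Cutting out the closed parts of a walk leaves a path, not longer if costs are nonnegative.
\<close>

lemma shortcut:
  assumes "xs \<noteq> []" "successively R xs" "\<And>x y. R x y \<Longrightarrow> 0 \<le> f x y"
  obtains ys where "ys \<noteq> []" "hd ys = hd xs" "last ys = last xs" "distinct ys"
    "set ys \<subseteq> set xs" "successively R ys" "list_length f ys \<le> list_length f xs"
proof -
  have "\<exists>ys. ys \<noteq> [] \<and> hd ys = hd xs \<and> last ys = last xs \<and> distinct ys \<and>
    set ys \<subseteq> set xs \<and> successively R ys \<and> list_length f ys \<le> list_length f xs"
    using assms(1,2)
  proof (induction xs)
    case (Cons x ws)
    show ?case
    proof (cases ws)
      case Nil
      then show ?thesis by (intro exI[of _ "[x]"]) auto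
    next
      case (Cons w ws')
      obtain ys where ys: "ys \<noteq> []" "hd ys = hd ws" "last ys = last ws" "distinct ys"
          "set ys \<subseteq> set ws" "successively R ys" "list_length f ys \<le> list_length f ws"
        using Cons.IH Cons.prems Cons by auto
      have R: "R x w" using Cons.prems Cons by auto
      show ?thesis
      proof (cases "x \<in> set ys")
        case False
        obtain y ys' where "ys = y # ys'" using ys(1) by (cases ys) auto
        then show ?thesis using ys R False Cons
          by (intro exI[of _ "x # ys"]) auto
      next
        case True
        then obtain as bs where s: "ys = as @ x # bs" by (meson split_list)
        have "successively R (as @ [x])" and sb: "successively R (x # bs)"
          using ys(6) successively_append_Cons[of R as x bs] s by auto
        then have "0 \<le> list_length f (as @ [x])"
          using list_length_mono_successively[of R "as @ [x]" "\<lambda>_ _. 0" f] assms(3)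
          by (simp add: list_length_def split_def)
        then have "list_length f (x # bs) \<le> list_length f ws"
          using ys(7) s list_length_append[of f as x bs] by simp
        then have "list_length f (x # bs) \<le> list_length f (x # ws)"
          using assms(3)[OF R] Cons by simp
        moreover have "last (x # bs) = last (x # ws)" using ys(3) s Cons by simp
        ultimately show ?thesis using ys s sb
          by (intro exI[of _ "x # bs"]) auto
      qed
    qed
  qed simp
  then show thesis using that by blast
qed

text \<open>
  A walk with ends on different sides of a bipartition \<open>S\<close> has a step across it.
\<close>

lemma crossing:
  assumes "xs \<noteq> []" "successively R xs" "S (hd xs) \<noteq> (S (last xs) :: bool)"
  obtains x y where "x \<in> set xs" "y \<in> set xs" "R x y" "S x = S (hd xs)" "S y \<noteq> S (hd xs)"
proof -
  have "\<exists>x y. x \<in> set xs \<and> y \<in> set xs \<and> R x y \<and> S x = S (hd xs) \<and> S y \<noteq> S (hd xs)"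
    using assms
  proof (induction xs rule: induct_list012)
    case (3 x y zs)
    show ?case
    proof (cases "S x = S y")
      case True
      then have "S (hd (y # zs)) \<noteq> S (last (y # zs))" using 3(5) by auto
      from 3(2)[OF _ _ this] 3(4) obtain u v where
        "u \<in> set (y # zs)" "v \<in> set (y # zs)" "R u v" "S u = S y" "S v \<noteq> S y"
        by auto
      then show ?thesis using True by (intro exI[of _ u] exI[of _ v]) auto
    next
      case False
      then show ?thesis using 3(4) by (intro exI[of _ x] exI[of _ y]) auto
    qed
  qed auto
  then show thesis using that by blast
qed

lemma rtranclp_imp_walk:
  assumes "R\<^sup>*\<^sup>* u v"
  obtains xs where "xs \<noteq> []" "hd xs = u" "last xs = v" "successively R xs"
proof -
  have "\<exists>xs. xs \<noteq> [] \<and> hd xs = u \<and> last xs = v \<and> successively R xs"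
    using assms
  proof (induction rule: converse_rtranclp_induct)
    case base
    show ?case by (intro exI[of _ "[v]"]) auto
  next
    case (step y z)
    then obtain xs where "xs \<noteq> []" "hd xs = z" "last xs = v" "successively R xs" by blast
    then show ?case using step(1)
      by (intro exI[of _ "y # xs"]) (auto simp: successively_Cons)
  qed
  then show thesis using that by blast
qed

lemma rtranclp_imp_path:
  assumes "R\<^sup>*\<^sup>* u v"
  obtains ys where "ys \<noteq> []" "hd ys = u" "last ys = v" "distinct ys" "successively R ys"
proof -
  obtain xs where xs: "xs \<noteq> []" "hd xs = u" "last xs = v" "successively R xs"
    using rtranclp_imp_walk[OF assms] .
  obtain ys where "ys \<noteq> []" "hd ys = hd xs" "last ys = last xs" "distinct ys"
      "set ys \<subseteq> set xs" "successively R ys" "list_length (\<lambda>_ _. 0) ys \<le> list_length (\<lambda>_ _. 0) xs"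
    by (rule shortcut[OF xs(1,4), where f = "\<lambda>_ _. 0"]) auto
  then show thesis using that xs by simp
qed


section \<open>Distances in connected weighted graphs\<close>

lemma edgeE:
  assumes "weighted_graph G" "e \<in> edges G"
  obtains a b where "e = {a, b}" "a \<in> verts G" "b \<in> verts G" "a \<noteq> b"
  using assms unfolding weighted_graph_def by blast

lemma edge_verts:
  assumes "weighted_graph G" "{a, b} \<in> edges G"
  shows "a \<in> verts G" "b \<in> verts G" "a \<noteq> b"
  using edgeE[OF assms] by (metis doubleton_eq_iff)+

lemma walk_verts:
  assumes G: "weighted_graph G" and "successively (\<lambda>x y. {x, y} \<in> edges G) xs"
    and "xs \<noteq> []" "hd xs \<in> verts G"
  shows "set xs \<subseteq> verts G"
  using assms(2-)
proof (induction xs rule: induct_list012)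
  case (3 x y zs)
  then have "{x, y} \<in> edges G" by simp
  then have "y \<in> verts G" using edge_verts[OF G] by blast
  then show ?case using 3 by auto
qed auto

lemma finite_edges: "weighted_graph G \<Longrightarrow> finite (edges G)"
  by (rule finite_subset[of _ "Pow (verts G)"]) (auto simp: weighted_graph_def)

lemma weight_nonneg: "weighted_graph G \<Longrightarrow> e \<in> edges G \<Longrightarrow> 0 \<le> weight G e"
  by (simp add: weighted_graph_def)

lemma connected_graphI:
  assumes "weighted_graph G"
    and "\<And>u v. u \<in> verts G \<Longrightarrow> v \<in> verts G \<Longrightarrow> (\<lambda>x y. {x, y} \<in> edges G)\<^sup>*\<^sup>* u v"
  shows "connected_graph G"
  unfolding connected_graph_def
proof (intro ballI)
  fix u v assume V: "u \<in> verts G" "v \<in> verts G"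
  obtain xs where "xs \<noteq> []" "hd xs = u" "last xs = v" "distinct xs"
      "successively (\<lambda>x y. {x, y} \<in> edges G) xs"
    using rtranclp_imp_path[OF assms(2)[OF V]] .
  then show "\<exists>xs. graph_path G u v xs"
    using walk_verts[OF assms(1)] V unfolding graph_path_def by metis
qed

lemma finite_paths: "weighted_graph G \<Longrightarrow> finite {xs. graph_path G u v xs}"
  by (rule finite_subset[OF _ finite_subset_distinct[of "verts G"]])
    (auto simp: graph_path_def weighted_graph_def)

lemma finite_path_weights:
  "weighted_graph G \<Longrightarrow> finite {path_weight G xs | xs. graph_path G u v xs}"
  using finite_paths[of G u v] by (simp add: setcompr_eq_image)

lemma graph_dist_attained:
  assumes "weighted_graph G" "connected_graph G" "u \<in> verts G" "v \<in> verts G"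
  obtains xs where "graph_path G u v xs" "path_weight G xs = graph_dist G u v"
proof -
  have "{path_weight G xs | xs. graph_path G u v xs} \<noteq> {}"
    using assms unfolding connected_graph_def by blast
  from Min_in[OF finite_path_weights[OF assms(1)] this]
  have "\<exists>xs. graph_path G u v xs \<and> path_weight G xs = graph_dist G u v"
    unfolding graph_dist_def by force
  then show thesis using that by blast
qed

lemma graph_dist_le_walk:
  assumes G: "weighted_graph G" and "xs \<noteq> []" "set xs \<subseteq> verts G"
    and "successively (\<lambda>x y. {x, y} \<in> edges G) xs"
  shows "graph_dist G (hd xs) (last xs) \<le> path_weight G xs"
proof -
  obtain ys where ys: "ys \<noteq> []" "hd ys = hd xs" "last ys = last xs" "distinct ys"
      "set ys \<subseteq> set xs" "successively (\<lambda>x y. {x, y} \<in> edges G) ys"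
      "list_length (\<lambda>x y. weight G {x, y}) ys \<le> list_length (\<lambda>x y. weight G {x, y}) xs"
    by (rule shortcut[OF assms(2,4), where f = "\<lambda>x y. weight G {x, y}"])
      (use weight_nonneg[OF G] in auto)
  have "graph_path G (hd xs) (last xs) ys"
    using ys assms(3) by (auto simp: graph_path_def)
  then have "graph_dist G (hd xs) (last xs) \<le> path_weight G ys"
    unfolding graph_dist_def by (intro Min_le finite_path_weights[OF G]) auto
  then show ?thesis using ys(7) by (simp add: path_weight_eq_list_length)
qed

lemma path_weight_nonneg:
  assumes "weighted_graph G" "graph_path G u v xs"
  shows "0 \<le> path_weight G xs"
  using list_length_mono_successively[of "\<lambda>x y. {x, y} \<in> edges G" xs "\<lambda>_ _. 0"
      "\<lambda>x y. weight G {x, y}"] assms weight_nonneg[OF assms(1)]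
  by (simp add: graph_path_def path_weight_eq_list_length) (simp add: list_length_def split_def)

lemma graph_dist_nonneg:
  assumes "weighted_graph G" "connected_graph G" "u \<in> verts G" "v \<in> verts G"
  shows "0 \<le> graph_dist G u v"
  using graph_dist_attained[OF assms] path_weight_nonneg[OF assms(1)] by metis

lemma graph_dist_triangle:
  assumes G: "weighted_graph G" "connected_graph G"
    and V: "u \<in> verts G" "v \<in> verts G" "w \<in> verts G"
  shows "graph_dist G u w \<le> graph_dist G u v + graph_dist G v w"
proof -
  obtain xs where xs: "graph_path G u v xs" "path_weight G xs = graph_dist G u v"
    using graph_dist_attained[OF G V(1,2)] .
  obtain ys where ys: "graph_path G v w ys" "path_weight G ys = graph_dist G v w"
    using graph_dist_attained[OF G V(2,3)] .
  obtain as where as: "xs = as @ [v]"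
    using xs(1) by (metis append_butlast_last_id graph_path_def)
  obtain bs where bs: "ys = v # bs"
    using ys(1) by (metis graph_path_def list.collapse)
  let ?zs = "as @ v # bs"
  have "graph_dist G (hd ?zs) (last ?zs) \<le> path_weight G ?zs"
    using xs(1) ys(1) as bs successively_append_Cons[of "\<lambda>x y. {x, y} \<in> edges G" as v bs]
    by (intro graph_dist_le_walk[OF G(1)]) (auto simp: graph_path_def)
  moreover have "hd ?zs = u" using xs(1) as by (cases as) (auto simp: graph_path_def)
  moreover have "last ?zs = w" using ys(1) bs by (auto simp: graph_path_def)
  moreover have "path_weight G ?zs = path_weight G xs + path_weight G ys"
    using as bs list_length_append by (simp add: path_weight_eq_list_length)
  ultimately show ?thesis using xs(2) ys(2) by simp
qed

lemma graph_dist_edge: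
  assumes "weighted_graph G" "{x, y} \<in> edges G"
  shows "graph_dist G x y \<le> weight G {x, y}"
  using graph_dist_le_walk[OF assms(1), of "[x, y]"] edge_verts[OF assms] assms(2)
  by (simp add: path_weight_eq_list_length)

lemma path_weight_eq_sum:
  assumes "distinct xs" "successively (\<lambda>x y. {x, y} \<in> edges G) xs"
  shows "\<exists>F\<subseteq>edges G. finite F \<and> (\<forall>e\<in>F. e \<subseteq> set xs) \<and> path_weight G xs = sum (weight G) F"
  using assms
proof (induction xs rule: induct_list012)
  case (3 x y zs)
  then obtain F where F: "F \<subseteq> edges G" "finite F" "\<forall>e\<in>F. e \<subseteq> set (y # zs)"
    "path_weight G (y # zs) = sum (weight G) F"
    by auto
  moreover have "{x, y} \<notin> F" using F(3) 3(3) by auto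
  ultimately show ?case using 3(4)
    by (intro exI[of _ "insert {x, y} F"]) (auto simp: path_weight_eq_list_length)
qed (rule exI[of _ "{}"], simp add: path_weight_eq_list_length)+

text \<open>
  The walk follows a shortest path from \<open>q\<close> to \<open>p\<close> and makes a detour, there and back, along
  one further edge for each vertex off that path.
\<close>

lemma spanning_walk:
  assumes G: "weighted_graph G" "connected_graph G" and V: "q \<in> verts G" "p \<in> verts G"
  obtains W where "W \<noteq> []" "hd W = q" "last W = p" "set W = verts G"
    "successively (\<lambda>x y. {x, y} \<in> edges G) W"
    "path_weight G W + graph_dist G q p \<le> 2 * total_weight G"
proof -
  define R where "R = (\<lambda>x y. {x, y} \<in> edges G)"
  \<comment> \<open>\<open>F\<close> collects the edges used so far: those of the shortest path once, the others twice.\<close>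
  define inv where "inv W F \<longleftrightarrow> W \<noteq> [] \<and> hd W = q \<and> last W = p \<and> set W \<subseteq> verts G \<and>
    successively R W \<and> F \<subseteq> edges G \<and> (\<forall>e\<in>F. e \<subseteq> set W) \<and>
    path_weight G W + graph_dist G q p = 2 * sum (weight G) F" for W F
  have step: "\<exists>W' F'. inv W' F' \<and> set W' = verts G" if "inv W F" for W F
    using that
  proof (induction "card (verts G - set W)" arbitrary: W F rule: less_induct)
    case less
    show ?case
    proof (cases "set W = verts G")
      case False
      then obtain z where z: "z \<in> verts G" "z \<notin> set W"
        using less.prems unfolding inv_def by blast
      have qW: "q \<in> set W" using less.prems unfolding inv_def by auto
      obtain xs where xs: "graph_path G q z xs"
        using G(2) V(1) z(1) unfolding connected_graph_def by blast
      obtain s v where sv: "R s v" "s \<in> set W" "v \<notin> set W" "v \<in> set xs"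
        using crossing[of xs R "\<lambda>x. x \<in> set W"] xs qW z(2)
        unfolding graph_path_def R_def by (metis (no_types, lifting))
      have v: "v \<in> verts G" using sv xs by (auto simp: graph_path_def)
      obtain as bs where W: "W = as @ s # bs" using sv(2) by (meson split_list)
      let ?W = "as @ s # v # s # bs" and ?F = "insert {s, v} F"
      have fin: "finite F" using less.prems finite_edges[OF G(1)] finite_subset
        unfolding inv_def by blast
      have new: "{s, v} \<notin> F" using less.prems sv unfolding inv_def by auto
      have vs: "{v, s} = {s, v}" by auto
      have len: "path_weight G ?W = path_weight G W + 2 * weight G {s, v}"
        unfolding path_weight_eq_list_length W
        by (subst (1 2) list_length_append) (simp add: vs)
      have suc: "successively R ?W"
        using less.prems sv(1) vs unfolding inv_def W R_def
        by (subst successively_append_Cons, subst (asm) successively_append_Cons) auto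
      have "hd ?W = q" using less.prems unfolding inv_def W by (cases as) auto
      then have "inv ?W ?F"
        using less.prems len suc fin new v sv(1) unfolding inv_def W R_def by auto
      moreover have "card (verts G - set ?W) < card (verts G - set W)"
        using G(1) v sv(3) W by (intro psubset_card_mono) (auto simp: weighted_graph_def)
      ultimately show ?thesis using less.hyps by blast
    qed (use less.prems in blast)
  qed
  obtain xs where xs: "graph_path G q p xs" "path_weight G xs = graph_dist G q p"
    using graph_dist_attained[OF G V] .
  have path: "xs \<noteq> []" "hd xs = q" "last xs = p" "set xs \<subseteq> verts G" "distinct xs"
      "successively R xs"
    using xs(1) by (simp_all add: graph_path_def R_def)
  obtain F where F: "F \<subseteq> edges G" "\<forall>e\<in>F. e \<subseteq> set xs"
      "path_weight G xs = sum (weight G) F"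
    using path_weight_eq_sum[OF path(5) path(6)[unfolded R_def]] by blast
  then have "inv xs F" using xs(2) path by (simp add: inv_def)
  from step[OF this] obtain W' F' where W': "inv W' F'" "set W' = verts G" by blast
  moreover have "sum (weight G) F' \<le> total_weight G"
    using W'(1) unfolding total_weight_def inv_def
    by (intro sum_mono2) (auto simp: finite_edges[OF G(1)] weight_nonneg[OF G(1)])
  ultimately show thesis
    using that[of W'] unfolding inv_def R_def by auto
qed

text \<open>
  The tour consists of the step from \<open>p\<close> to \<open>q\<close> and the visits to \<open>M\<close> of a spanning walk from
  \<open>q\<close> to \<open>p\<close>. The summand \<open>graph_dist H q p - \<rho> q p\<close> is what is gained over the bound
  \<open>2 * total_weight H\<close> because this step costs only \<open>\<rho> q p\<close>.
\<close>

lemma filling_tour: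
  assumes fill: "filling M \<rho> H" and pq: "q \<in> M" "p \<in> M" and sym: "\<rho> p q = \<rho> q p"
  obtains L where "L \<noteq> []" "hd L = last L" "set L = M"
    "list_length \<rho> L + (graph_dist H q p - \<rho> q p) \<le> 2 * total_weight H"
proof -
  have H: "weighted_graph H" "connected_graph H" "M \<subseteq> verts H"
    and dom: "\<And>x y. x \<in> M \<Longrightarrow> y \<in> M \<Longrightarrow> \<rho> x y \<le> graph_dist H x y"
    using fill by (auto simp: filling_def joins_def)
  obtain W where W: "W \<noteq> []" "hd W = q" "last W = p" "set W = verts H"
      "successively (\<lambda>x y. {x, y} \<in> edges H) W"
      "path_weight H W + graph_dist H q p \<le> 2 * total_weight H"
    by (rule spanning_walk[OF H(1,2), of q p]) (use pq H(3) in auto)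
  obtain W' where W': "W = q # W'" using W(1,2) by (cases W) auto
  let ?F = "filter (\<lambda>x. x \<in> M) W"
  have F: "?F = q # filter (\<lambda>x. x \<in> M) W'" using W' pq by simp
  have setF: "set ?F = M" using W(4) H(3) by auto
  have "list_length \<rho> ?F \<le> list_length (graph_dist H) ?F"
    using setF by (intro list_length_mono dom) auto
  also have "\<dots> \<le> list_length (graph_dist H) W"
  proof -
    have "list_length (graph_dist H) (q # filter (\<lambda>x. x \<in> M) W') \<le>
      list_length (graph_dist H) (q # W')"
      using W(4) W'
      by (intro list_length_filter_le[of _ _ "verts H"])
        (auto intro: graph_dist_nonneg[OF H(1,2)] graph_dist_triangle[OF H(1,2)])
    then show ?thesis using F W' by simp
  qed
  also have "\<dots> \<le> path_weight H W"
    unfolding path_weight_eq_list_length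
    by (rule list_length_mono_successively[OF W(5)]) (rule graph_dist_edge[OF H(1)])
  finally have le: "list_length \<rho> ?F \<le> path_weight H W" .
  have lastF: "last ?F = p"
  proof -
    have "W = butlast W @ [p]" using W(1,3) by (metis append_butlast_last_id)
    then have "?F = filter (\<lambda>x. x \<in> M) (butlast W) @ [p]"
      using pq(2) by (metis filter.simps(1,2) filter_append)
    then show ?thesis by simp
  qed
  show thesis
  proof (rule that[of "p # ?F"])
    show "hd (p # ?F) = last (p # ?F)" using lastF F by simp
    show "set (p # ?F) = M" using setF pq by auto
    show "list_length \<rho> (p # ?F) + (graph_dist H q p - \<rho> q p) \<le> 2 * total_weight H"
      using le W(6) sym F by simp
  qed simp
qed


section \<open>Trees through the cuts of their edges\<close>

text \<open>
  A tree, presented by its cuts: deleting an edge \<open>e\<close> leaves two components, and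
  \<open>S e\<close> tells them apart, so that \<open>e\<close> is the only edge with ends on different sides.
  Which of the two sides is called \<^const>\<open>True\<close> is immaterial.
\<close>

locale cut_tree =
  fixes G :: "'a wgraph" and S :: "'a set \<Rightarrow> 'a \<Rightarrow> bool"
  assumes weighted: "weighted_graph G" and connected: "connected_graph G"
    and cut: "\<And>e x y. e \<in> edges G \<Longrightarrow> {x, y} \<in> edges G \<Longrightarrow> S e x \<noteq> S e y \<longleftrightarrow> {x, y} = e"
begin

text \<open>
  The vertex \<open>z\<close> lies on the path from \<open>x\<close> to \<open>y\<close>; the weights play no role.
\<close>

definition between :: "'a \<Rightarrow> 'a \<Rightarrow> 'a \<Rightarrow> bool" where
  "between x z y \<longleftrightarrow> (\<forall>e\<in>edges G. S e x = S e y \<longrightarrow> S e z = S e x)"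

text \<open>The path metric of the tree: the total weight of the edges that separate two vertices.\<close>

definition cut_dist :: "'a \<Rightarrow> 'a \<Rightarrow> real" where
  "cut_dist x y = (\<Sum>e\<in>edges G. weight G e * of_bool (S e x \<noteq> S e y))"

lemma between_sym: "between x z y \<longleftrightarrow> between y z x"
  by (auto simp: between_def)

lemma between_trans:
  assumes "between u p n" "between u v p"
  shows "between u v n"
  using assms by (auto simp: between_def)

text \<open>
  A path uses every edge at most once, so it never returns to a side of an edge that it has left.
\<close>

lemma path_between:
  assumes path: "graph_path G x y xs" and z: "z \<in> set xs"
  shows "between x z y"
  unfolding between_def
proof (intro ballI impI, rule ccontr)
  fix e assume e: "e \<in> edges G" "S e x = S e y" "S e z \<noteq> S e x"
  obtain as bs where xs: "xs = as @ z # bs" using z by (meson split_list)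
  define R where "R = (\<lambda>x y. {x, y} \<in> edges G)"
  have suc: "successively R (as @ [z])" "successively R (z # bs)"
    using path successively_append_Cons[of R as z bs]
    unfolding graph_path_def xs R_def by auto
  have ends: "hd (as @ [z]) = x" "last (z # bs) = y"
    using path unfolding graph_path_def xs by (cases as; auto)+
  obtain u v where uv: "u \<in> set (as @ [z])" "v \<in> set (as @ [z])" "R u v" "S e u \<noteq> S e v"
    by (rule crossing[OF _ suc(1), of "S e"]) (use ends e in auto)
  obtain u' v' where uv': "u' \<in> set (z # bs)" "v' \<in> set (z # bs)" "R u' v'" "S e u' \<noteq> S e v'"
    by (rule crossing[OF _ suc(2), of "S e"]) (use ends e in auto)
  \<comment> \<open>The path would use the edge \<open>e\<close> both before and after \<open>z\<close>.\<close>
  have "{u, v} = e" "{u', v'} = e" using cut uv uv' e(1) unfolding R_def by blast+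
  then have "{u, v} \<subseteq> set (as @ [z]) \<inter> set (z # bs)" using uv uv' by auto
  also have "\<dots> = {z}" using path unfolding graph_path_def xs by auto
  finally show False using uv(4) by auto
qed

lemma edge_between:
  assumes e: "{a, b} \<in> edges G" "S {a, b} x \<noteq> S {a, b} y" and V: "x \<in> verts G" "y \<in> verts G"
  shows "between x a y"
proof -
  obtain xs where xs: "graph_path G x y xs"
    using connected V unfolding connected_graph_def by blast
  obtain u v where uv: "u \<in> set xs" "v \<in> set xs" "{u, v} \<in> edges G" "S {a, b} u \<noteq> S {a, b} v"
    by (rule crossing[of xs "\<lambda>x y. {x, y} \<in> edges G" "S {a, b}"])
      (use xs e(2) in \<open>auto simp: graph_path_def\<close>)
  have "{u, v} = {a, b}" using cut[OF e(1) uv(3)] uv(4) by simp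
  then have "a \<in> set xs" using uv(1,2) by (auto simp: doubleton_eq_iff)
  then show ?thesis using path_between[OF xs] by blast
qed

lemma first_edge:
  assumes V: "x \<in> verts G" "y \<in> verts G" and "x \<noteq> y"
  obtains n where "{x, n} \<in> edges G" "S {x, n} x \<noteq> S {x, n} y"
proof -
  obtain xs where xs: "graph_path G x y xs"
    using connected V unfolding connected_graph_def by blast
  then obtain n zs where zs: "xs = x # n # zs"
    using assms(3) unfolding graph_path_def
    by (metis last_ConsL list.collapse)
  then have e: "{x, n} \<in> edges G" using xs by (auto simp: graph_path_def)
  have "S {x, n} x \<noteq> S {x, n} n" using cut[OF e e] by simp
  moreover have "between x n y" using path_between[OF xs] zs by simp
  ultimately have "S {x, n} x \<noteq> S {x, n} y" using e unfolding between_def by metis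
  then show thesis using that e by blast
qed

lemma vertex_eqI:
  assumes "x \<in> verts G" "y \<in> verts G" "\<And>e. e \<in> edges G \<Longrightarrow> S e x = S e y"
  shows "x = y"
  using first_edge[of x y] assms by metis

text \<open>
  At most one of the edges at \<open>v\<close> separates \<open>v\<close> from \<open>x\<close>.
\<close>

lemma first_edge_unique:
  assumes e: "{v, n} \<in> edges G" "{v, n'} \<in> edges G" "n \<noteq> n'"
    and sep: "S {v, n} v \<noteq> S {v, n} x" and x: "x \<in> verts G"
  shows "S {v, n'} v = S {v, n'} x"
proof (rule ccontr)
  assume sep': "S {v, n'} v \<noteq> S {v, n'} x"
  have ne: "{v, n'} \<noteq> {v, n}" using e(3) by (auto simp: doubleton_eq_iff)
  have "S {v, n} n' = S {v, n} v" using cut[OF e(1,2)] ne by simp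
  then have "between x v n'"
    using edge_between[OF e(1), of x n'] sep x edge_verts[OF weighted e(2)] by metis
  moreover have "S {v, n'} n' = S {v, n'} x" using sep' cut[OF e(2,2)] by auto
  ultimately show False using e(2) sep' unfolding between_def by metis
qed

lemma between_one_of_two:
  assumes "between p v q" and V: "p \<in> verts G" "q \<in> verts G" "v \<in> verts G" "x \<in> verts G"
  shows "between x v p \<or> between x v q"
proof (rule ccontr)
  assume "\<not> ?thesis"
  then obtain e f where e: "e \<in> edges G" "S e x = S e p" "S e v \<noteq> S e x"
    and f: "f \<in> edges G" "S f x = S f q" "S f v \<noteq> S f x"
    unfolding between_def by blast
  obtain a b where ab: "e = {a, b}" using edgeE[OF weighted e(1)] by metis
  have eq: "S e q = S e v" "S f p = S f v" using assms(1) e f unfolding between_def by metis+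
  \<comment> \<open>The end \<open>a\<close> of \<open>e\<close> is both between \<open>x\<close> and \<open>q\<close> and between \<open>p\<close> and \<open>v\<close>,
    which lie on different sides of \<open>f\<close>.\<close>
  have "between x a q" "between p a v"
    using edge_between e eq ab V by metis+
  then have "S f a = S f x" "S f a = S f p" using f eq unfolding between_def by auto
  then show False using f eq by simp
qed

lemma median_exists:
  assumes V: "p \<in> verts G" "q \<in> verts G" "r \<in> verts G"
  obtains v where "v \<in> verts G" "between p v q" "between p v r" "between q v r"
proof -
  \<comment> \<open>The median is the vertex of the path from \<open>p\<close> to \<open>q\<close> closest to \<open>r\<close>.\<close>
  define m where "m v = card {e \<in> edges G. S e v \<noteq> S e r}" for v
  have "p \<in> verts G \<and> between p p q" using V by (simp add: between_def)
  from ex_has_least_nat[of "\<lambda>v. v \<in> verts G \<and> between p v q", OF this, of m]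
  obtain v where v: "v \<in> verts G" "between p v q"
    and min: "\<And>y. y \<in> verts G \<Longrightarrow> between p y q \<Longrightarrow> m v \<le> m y" by blast
  have "between s v r" if "between s v t" "\<And>y. between s y t \<Longrightarrow> between p y q"
    "s \<in> verts G" "t \<in> verts G" for s t
  proof (rule ccontr)
    assume "\<not> between s v r"
    then obtain e where e: "e \<in> edges G" "S e s = S e r" "S e v \<noteq> S e s"
      unfolding between_def by blast
    have st: "S e s \<noteq> S e t" using that(1) e unfolding between_def by metis
    obtain a b where ab: "e = {a, b}" "S e a = S e s" "a \<in> verts G"
    proof -
      obtain a b where ab: "e = {a, b}" "a \<in> verts G" "b \<in> verts G"
        using edgeE[OF weighted e(1)] by metis
      then have "S e a \<noteq> S e b" using cut[of e a b] e(1) by simp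
      then have "S e a = S e s \<or> S e b = S e s" by auto
      then show thesis using that[of a b] that[of b a] ab by (auto simp: insert_commute)
    qed
    have "between s a t" using edge_between e(1) ab(1) st that(3,4) by metis
    then have "m v \<le> m a" using min ab(3) that(2) by blast
    moreover have "between v a r" using edge_between e ab(1) v(1) V(3) by metis
    then have "{e \<in> edges G. S e a \<noteq> S e r} \<subseteq> {e \<in> edges G. S e v \<noteq> S e r}"
      unfolding between_def by auto
    then have "{e \<in> edges G. S e a \<noteq> S e r} \<subset> {e \<in> edges G. S e v \<noteq> S e r}"
      using e ab(2) by blast
    then have "m a < m v" unfolding m_def
      using finite_edges[OF weighted] by (intro psubset_card_mono) auto
    ultimately show False by simp
  qed
  from this[of p q] this[of q p] v V have "between p v r" "between q v r"
    by (auto simp: between_sym[of q])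
  then show thesis using that v by blast
qed

lemma cut_dist_nonneg: "0 \<le> cut_dist x y"
  unfolding cut_dist_def by (intro sum_nonneg) (simp add: weight_nonneg[OF weighted])

lemma cut_dist_self [simp]: "cut_dist x x = 0"
  by (simp add: cut_dist_def)

lemma cut_dist_commute: "cut_dist x y = cut_dist y x"
  unfolding cut_dist_def by (intro sum.cong) auto

lemma cut_dist_triangle: "cut_dist x y \<le> cut_dist x z + cut_dist z y"
  unfolding cut_dist_def sum.distrib[symmetric]
  by (intro sum_mono) (auto simp: weight_nonneg[OF weighted])

lemma cut_dist_between: "between x z y \<Longrightarrow> cut_dist x y = cut_dist x z + cut_dist z y"
  unfolding cut_dist_def sum.distrib[symmetric] between_def
  by (intro sum.cong) auto

lemma cut_dist_edge:
  assumes "{x, y} \<in> edges G"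
  shows "cut_dist x y = weight G {x, y}"
proof -
  have "cut_dist x y = (\<Sum>e\<in>edges G. if e = {x, y} then weight G e else 0)"
    unfolding cut_dist_def using cut[OF _ assms] by (intro sum.cong) auto
  then show ?thesis using assms finite_edges[OF weighted] by simp
qed

lemma path_weight_eq_cut_dist: "graph_path G x y xs \<Longrightarrow> path_weight G xs = cut_dist x y"
proof (induction xs arbitrary: x rule: induct_list012)
  case (3 a b zs)
  have a: "a = x" and e: "{x, b} \<in> edges G" and p: "graph_path G b y (b # zs)"
    using 3(3) by (auto simp: graph_path_def)
  have "between x b y" using path_between[OF 3(3)] by simp
  then show ?case
    using cut_dist_between cut_dist_edge[OF e] 3(2)[OF p] a
    by (simp add: path_weight_eq_list_length)
qed (auto simp: graph_path_def path_weight_eq_list_length)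

lemma graph_dist_eq_cut_dist:
  assumes "x \<in> verts G" "y \<in> verts G"
  shows "graph_dist G x y = cut_dist x y"
  using graph_dist_attained[OF weighted connected assms] path_weight_eq_cut_dist by metis

lemma acyclic: "\<nexists>xs. graph_cycle G xs"
proof
  assume "\<exists>xs. graph_cycle G xs"
  then obtain xs where xs: "3 \<le> length xs" "distinct xs"
    "successively (\<lambda>x y. {x, y} \<in> edges G) xs" "{last xs, hd xs} \<in> edges G" "set xs \<subseteq> verts G"
    by (auto simp: graph_cycle_def)
  then obtain x y z zs where s: "xs = x # y # z # zs"
    by (metis One_nat_def Suc_le_length_iff numeral_3_eq_3)
  let ?l = "last (z # zs)"
  have e: "{?l, x} \<in> edges G" and l: "?l \<in> set (z # zs)" using xs(4) s by auto
  have p: "graph_path G x ?l xs" using xs s by (auto simp: graph_path_def)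
  have xy: "{x, y} \<in> edges G" using xs(3) s by simp
  have "{?l, x} \<noteq> {x, y}" using l xs(2) s by (auto simp: doubleton_eq_iff)
  then have "S {x, y} x = S {x, y} ?l" using cut[OF xy e] by auto
  moreover have "between x y ?l" using path_between[OF p] s by simp
  ultimately have "S {x, y} y = S {x, y} x" using xy unfolding between_def by blast
  then show False using cut[OF xy xy] by simp
qed

end

text \<open>
  In an acyclic graph every edge is a bridge, because a path between its ends that avoids the
  edge would close up to a cycle.
\<close>

lemma acyclic_imp_cut_tree:
  assumes G: "weighted_graph G" "connected_graph G" and acyc: "\<nexists>xs. graph_cycle G xs"
  shows "\<exists>S. cut_tree G S"
proof -
  define R where "R e = (\<lambda>x y. {x, y} \<in> edges G - {e})" for e
  \<comment> \<open>The vertices reachable from a fixed end of \<open>e\<close> without using \<open>e\<close>.\<close>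
  define S where "S e = (R e)\<^sup>*\<^sup>* (SOME a. a \<in> e)" for e
  have symR: "R e x y \<Longrightarrow> R e y x" for e x y by (simp add: R_def insert_commute)
  have "cut_tree G S"
  proof
    fix e x y assume e: "e \<in> edges G" and xy: "{x, y} \<in> edges G"
    show "S e x \<noteq> S e y \<longleftrightarrow> {x, y} = e"
    proof
      assume ne: "S e x \<noteq> S e y"
      show "{x, y} = e"
      proof (rule ccontr)
        assume "{x, y} \<noteq> e"
        then have "R e x y" using xy by (simp add: R_def)
        with symR[OF this] show False using ne unfolding S_def by (meson rtranclp.rtrancl_into_rtrancl)
      qed
    next
      assume eq: "{x, y} = e"
      define a where "a = (SOME a. a \<in> e)"
      have "a \<in> e" unfolding a_def using eq by (metis insertI1 someI)
      then obtain b where ab: "e = {a, b}" "{a, b} = {x, y}" using eq by auto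
      then have abV: "a \<in> verts G" "b \<in> verts G" "a \<noteq> b" using edge_verts[OF G(1)] e by metis+
      have "\<not> (R e)\<^sup>*\<^sup>* a b"
      proof
        assume "(R e)\<^sup>*\<^sup>* a b"
        then obtain ys where ys: "ys \<noteq> []" "hd ys = a" "last ys = b" "distinct ys"
            "successively (R e) ys"
          by (rule rtranclp_imp_path)
        obtain c cs where c: "ys = a # c # cs"
          using ys(1,2,3) abV(3) by (metis last_ConsL list.collapse)
        have "c \<noteq> b" using ys(5) c ab(1) by (auto simp: R_def)
        then have "cs \<noteq> []" using c ys(3) by auto
        have suc: "successively (\<lambda>x y. {x, y} \<in> edges G) ys"
          using ys(5) by (rule successively_mono) (auto simp: R_def)
        have "set ys \<subseteq> verts G" using walk_verts[OF G(1) suc] ys(1,2) abV(1) by simp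
        then have "graph_cycle G ys"
          using suc ys c \<open>cs \<noteq> []\<close> e ab(1) unfolding graph_cycle_def
          by (cases cs) (auto simp: insert_commute)
        then show False using acyc by blast
      qed
      then have "S e a \<noteq> S e b" unfolding S_def a_def[symmetric] by auto
      then show "S e x \<noteq> S e y" using ab(2) by (auto simp: doubleton_eq_iff)
    qed
  qed (fact G)+
  then show ?thesis by blast
qed


section \<open>Trees joining a set\<close>

text \<open>
  The requirement on vertices of degree 1 or 2 makes every vertex outside \<open>M\<close> either isolated or
  of degree at least three.
\<close>

locale cut_tree_joining = cut_tree G S
  for G :: "'a wgraph" and S :: "'a set \<Rightarrow> 'a \<Rightarrow> bool" +
  fixes M :: "'a set"
  assumes M_verts: "M \<subseteq> verts G"
    and degree: "\<And>v. v \<in> verts G \<Longrightarrow> vertex_degree G v \<in> {1, 2} \<Longrightarrow> v \<in> M"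
begin

lemma degree_ge_3:
  assumes v: "v \<in> verts G" "v \<notin> M" and e: "e \<in> edges G" "v \<in> e"
  shows "3 \<le> card {e \<in> edges G. v \<in> e}"
proof -
  have "card {e \<in> edges G. v \<in> e} \<noteq> 0"
    using e finite_edges[OF weighted] by auto
  moreover have "card {e \<in> edges G. v \<in> e} \<notin> {1, 2}"
    using degree[OF v(1)] v(2) unfolding vertex_degree_def by blast
  ultimately show ?thesis by auto
qed

lemma incident_edgeE:
  assumes "e \<in> edges G" "v \<in> e"
  obtains n where "e = {v, n}" "n \<in> verts G" "n \<noteq> v"
  using edgeE[OF weighted assms(1)] assms(2) by (metis doubleton_eq_iff insertE singletonD)

text \<open>
  Every path between distinct vertices can be prolonged to a point of \<open>M\<close>: at an end outside
  \<open>M\<close>, which has degree at least three, there is a further edge along which to go on.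
\<close>

lemma extend:
  assumes V: "u \<in> verts G" "v \<in> verts G" and "u \<noteq> v"
  obtains p where "p \<in> M" "between u v p"
proof -
  define m where "m p = card {e \<in> edges G. S e u \<noteq> S e p}" for p
  let ?P = "\<lambda>p. p \<in> verts G \<and> between u v p"
  have bound: "m p < Suc (card (edges G))" for p
    unfolding m_def less_Suc_eq_le using finite_edges[OF weighted] by (intro card_mono) auto
  have "?P v" using V by (simp add: between_def)
  then have "\<exists>p. ?P p \<and> (\<forall>y. ?P y \<longrightarrow> m y \<le> m p)"
    by (rule ex_has_greatest_nat) (use bound in auto)
  then obtain p where p: "p \<in> verts G" "between u v p"
    and max: "\<And>y. y \<in> verts G \<Longrightarrow> between u v y \<Longrightarrow> m y \<le> m p" by blast
  have "p \<in> M"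
  proof (rule ccontr)
    assume pM: "p \<notin> M"
    have "p \<noteq> u"
    proof
      assume "p = u"
      then have "S e u = S e v" if "e \<in> edges G" for e
        using p(2) that unfolding between_def by metis
      then show False using vertex_eqI V assms(3) by blast
    qed
    then obtain n0 where n0: "{p, n0} \<in> edges G" "S {p, n0} p \<noteq> S {p, n0} u"
      using first_edge p(1) V(1) by metis
    have "3 \<le> card {e \<in> edges G. p \<in> e}" using degree_ge_3[OF p(1) pM n0(1)] by simp
    then have "\<not> {e \<in> edges G. p \<in> e} \<subseteq> {{p, n0}}"
      using card_mono[of "{{p, n0}}" "{e \<in> edges G. p \<in> e}"] by auto
    then obtain e1 where e1: "e1 \<in> edges G" "p \<in> e1" "e1 \<noteq> {p, n0}" by auto
    obtain n1 where n1: "e1 = {p, n1}" "n1 \<in> verts G" using incident_edgeE[OF e1(1,2)] by metis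
    have same: "S e1 p = S e1 u"
      using first_edge_unique[OF n0(1), of n1] n0(2) e1 n1 V(1) by metis
    have diff: "S e1 p \<noteq> S e1 n1" using cut[of e1 p n1] e1(1) n1(1) by simp
    have other: "S f p = S f n1" if "f \<in> edges G" "f \<noteq> e1" for f
      using cut[of f p n1] that e1(1) n1(1) by auto
    have "between u p n1" unfolding between_def using same diff other by metis
    then have "between u v n1" using between_trans p(2) by blast
    then have "m n1 \<le> m p" using max n1(2) by blast
    moreover have "{e \<in> edges G. S e u \<noteq> S e p} \<subset> {e \<in> edges G. S e u \<noteq> S e n1}"
      using same diff other e1(1) by blast
    then have "m p < m n1"
      unfolding m_def using finite_edges[OF weighted] by (intro psubset_card_mono) auto
    ultimately show False by simp
  qed
  then show thesis using that p(2) by blast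
qed

lemma M_empty: "M = {} \<Longrightarrow> \<exists>v. verts G = {v} \<and> edges G = {}"
  using extend weighted edgeE[OF weighted]
  by (metis all_not_in_conv is_singletonI' is_singleton_def weighted_graph_def)

text \<open>
  For nonempty \<open>M\<close>, a vertex outside \<open>M\<close> has at least three branches, and each of them
  contains a point of \<open>M\<close>.
\<close>

lemma median_of_M:
  assumes v: "v \<in> verts G" "v \<notin> M" and "M \<noteq> {}"
  obtains p q r where "p \<in> M" "q \<in> M" "r \<in> M"
    "between p v q" "between p v r" "between q v r"
proof -
  obtain m where m: "m \<in> verts G" "m \<noteq> v" using assms M_verts by blast
  obtain n where n: "{v, n} \<in> edges G" using first_edge[OF v(1) m(1)] m(2) by metis
  have "3 \<le> card {e \<in> edges G. v \<in> e}" using degree_ge_3[OF v n] by simp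
  then obtain T where T: "T \<subseteq> {e \<in> edges G. v \<in> e}" "card T = 3"
    by (metis obtain_subset_with_card_n)
  then obtain e1 e2 e3 where "T = {e1, e2, e3}" and ne: "e1 \<noteq> e2" "e1 \<noteq> e3" "e2 \<noteq> e3"
    by (auto simp: card_3_iff)
  then have e: "e1 \<in> edges G" "v \<in> e1" "e2 \<in> edges G" "v \<in> e2" "e3 \<in> edges G" "v \<in> e3"
    using T(1) by auto
  have branch: "\<exists>p\<in>M. S e v \<noteq> S e p" if ev: "e \<in> edges G" "v \<in> e" for e
  proof -
    obtain n where n: "e = {v, n}" "n \<in> verts G" "n \<noteq> v" using incident_edgeE[OF ev] by metis
    obtain p where p: "p \<in> M" "between v n p" using extend[OF v(1) n(2)] n(3) by metis
    have "S e v \<noteq> S e n" using cut[of e v n] ev(1) n(1) by simp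
    then show ?thesis using p ev(1) unfolding between_def by metis
  qed
  have pair: "between p v q" if p: "p \<in> M" "S e v \<noteq> S e p" and q: "q \<in> M" "S f v \<noteq> S f q"
    and ef: "e \<in> edges G" "v \<in> e" "f \<in> edges G" "v \<in> f" "e \<noteq> f" for e f p q
  proof -
    obtain n where n: "e = {v, n}" using incident_edgeE[OF ef(1,2)] by metis
    obtain n' where n': "f = {v, n'}" using incident_edgeE[OF ef(3,4)] by metis
    have V: "p \<in> verts G" "q \<in> verts G" using p q M_verts by auto
    have "S e v = S e q"
      using first_edge_unique[of v n' n q] ef q V(2) n n' by blast
    then show ?thesis using edge_between[of v n p q] p(2) ef(1) V n by metis
  qed
  obtain p where p: "p \<in> M" "S e1 v \<noteq> S e1 p" using branch[OF e(1,2)] by blast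
  obtain q where q: "q \<in> M" "S e2 v \<noteq> S e2 q" using branch[OF e(3,4)] by blast
  obtain r where r: "r \<in> M" "S e3 v \<noteq> S e3 r" using branch[OF e(5,6)] by blast
  show thesis
    using that[OF p(1) q(1) r(1)] pair[OF p q e(1-4) ne(1)] pair[OF p r e(1,2,5,6) ne(2)]
      pair[OF q r e(3-6) ne(3)] by blast
qed

text \<open>
  Both components left by an edge contain points of \<open>M\<close>, so a closed tour through \<open>M\<close> crosses
  each edge at least twice.
\<close>

lemma tour_lower_bound:
  assumes "L \<noteq> []" "hd L = last L" "M \<subseteq> set L"
  shows "2 * total_weight G \<le> list_length cut_dist L"
proof -
  have twice: "2 \<le> list_length (\<lambda>x y. of_bool (S e x \<noteq> S e y)) L" if e: "e \<in> edges G" for e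
  proof -
    let ?g = "\<lambda>x y. of_bool (S e x \<noteq> S e y) :: real"
    obtain a b where ab: "e = {a, b}" "a \<in> verts G" "b \<in> verts G" "a \<noteq> b"
      using edgeE[OF weighted e] .
    have sep: "S e a \<noteq> S e b" using cut[of e a b] e ab(1) by simp
    obtain p where p: "p \<in> M" "between a b p" using extend[OF ab(2-4)] .
    obtain q where q: "q \<in> M" "between b a q" using extend[OF ab(3,2) ab(4)[symmetric]] .
    have "S e p \<noteq> S e q" using sep p(2) q(2) e unfolding between_def by metis
    then obtain z where z: "z \<in> M" "S e z \<noteq> S e (hd L)" using p(1) q(1) by metis
    then obtain as bs where L: "L = as @ z # bs" using assms(3) by (meson in_mono split_list)
    have "?g (hd (as @ [z])) (last (as @ [z])) \<le> list_length ?g (as @ [z])"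
      by (rule triangle_le_list_length[where V = UNIV]) auto
    moreover have "?g (hd (z # bs)) (last (z # bs)) \<le> list_length ?g (z # bs)"
      by (rule triangle_le_list_length[where V = UNIV]) auto
    moreover have "hd (as @ [z]) = hd L" "last (z # bs) = hd L"
      using L assms(2) by (cases as; simp)+
    ultimately show ?thesis
      using z(2) list_length_append[of ?g as z bs] L by simp
  qed
  have "2 * total_weight G = (\<Sum>e\<in>edges G. weight G e * 2)"
    by (simp add: total_weight_def sum_distrib_left mult.commute)
  also have "\<dots> \<le> (\<Sum>e\<in>edges G. weight G e * list_length (\<lambda>x y. of_bool (S e x \<noteq> S e y)) L)"
    by (intro sum_mono mult_left_mono twice weight_nonneg[OF weighted])
  also have "\<dots> = list_length cut_dist L"
    unfolding cut_dist_def list_length_sum list_length_mult ..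
  finally show ?thesis .
qed

text \<open>
  With \<open>p = q\<close> this is the minimality of a tree that generates \<open>\<rho>\<close>; for arbitrary \<open>p\<close> and \<open>q\<close> it
  forces a filling \<open>H\<close> of the same weight to have \<open>graph_dist H p q \<le> \<rho> p q\<close>.
\<close>

lemma filling_lower_bound:
  assumes fill: "filling M \<rho> H" and dist: "\<And>p q. p \<in> M \<Longrightarrow> q \<in> M \<Longrightarrow> \<rho> p q = cut_dist p q"
    and pq: "p \<in> M" "q \<in> M"
  shows "2 * total_weight G + (graph_dist H p q - \<rho> p q) \<le> 2 * total_weight H"
proof -
  obtain L where L: "L \<noteq> []" "hd L = last L" "set L = M"
    "list_length \<rho> L + (graph_dist H p q - \<rho> p q) \<le> 2 * total_weight H"
    by (rule filling_tour[OF fill pq]) (use dist pq cut_dist_commute in auto)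
  have "list_length cut_dist L \<le> list_length \<rho> L"
    using L(3) dist by (intro list_length_mono) auto
  then show ?thesis using tour_lower_bound[OF L(1,2)] L(3,4) by simp
qed

text \<open>
  The distances from a median \<open>v\<close> of three points \<open>p\<close>, \<open>q\<close>, \<open>r\<close> are determined by the distances
  \<open>cut_dist v p\<close>, \<open>cut_dist v q\<close>, \<open>cut_dist v r\<close> and by the metric on \<open>M\<close>: for each \<open>x\<close>, the vertex \<open>v\<close>
  lies between \<open>x\<close> and at least one of the three points.
\<close>

lemma cut_dist_max_formula:
  assumes v: "v \<in> verts G" "x \<in> verts G" and pqr: "p \<in> M" "q \<in> M" "r \<in> M"
    and med: "between p v q" "between p v r" "between q v r"
  shows "cut_dist v x =
    Max {cut_dist x p - cut_dist v p, cut_dist x q - cut_dist v q, cut_dist x r - cut_dist v r}"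
proof -
  have "between x v p \<or> between x v q"
    using between_one_of_two[OF med(1)] v pqr M_verts by blast
  then have "cut_dist x p = cut_dist x v + cut_dist v p \<or> cut_dist x q = cut_dist x v + cut_dist v q"
    using cut_dist_between by blast
  then show ?thesis
    using cut_dist_triangle[of x p v] cut_dist_triangle[of x q v] cut_dist_triangle[of x r v]
      cut_dist_commute[of v x]
    by (auto simp: max_def)
qed

end

lemma minimal_filling_of_generating_tree:
  fixes G :: "'a::infinite wgraph"
  assumes "cut_tree_joining G S M"
    and dist: "\<And>p q. p \<in> M \<Longrightarrow> q \<in> M \<Longrightarrow> \<rho> p q = cut_tree.cut_dist G S p q"
  shows "minimal_filling M \<rho> G"
  unfolding minimal_filling_def
proof (intro conjI allI impI)
  interpret cut_tree_joining G S M by fact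
  have "\<rho> p q \<le> graph_dist G p q" if "p \<in> M" "q \<in> M" for p q
    using graph_dist_eq_cut_dist[of p q] M_verts that dist[OF that] by (simp add: subset_iff)
  then show "filling M \<rho> G"
    using weighted connected M_verts by (simp add: filling_def joins_def)
  fix H assume H: "filling M \<rho> H"
  then have wH: "weighted_graph H" by (simp add: filling_def joins_def)
  show "total_weight G \<le> total_weight H"
  proof (cases "M = {}")
    case True
    have "edges G = {}" using M_empty[OF True] by auto
    then show ?thesis
      by (simp add: total_weight_def sum_nonneg weight_nonneg[OF wH])
  next
    case False
    then obtain p where p: "p \<in> M" by blast
    have "\<rho> p p \<le> graph_dist H p p" using H p by (simp add: filling_def)
    then show ?thesis using filling_lower_bound[OF H dist p p] by simp
  qed
qed

lemma minimal_filling_dist: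
  fixes G :: "'a::infinite wgraph"
  assumes G: "cut_tree_joining G S M" and min: "minimal_filling M \<rho> H"
    and dist: "\<And>p q. p \<in> M \<Longrightarrow> q \<in> M \<Longrightarrow> \<rho> p q = cut_tree.cut_dist G S p q"
    and pq: "p \<in> M" "q \<in> M"
  shows "graph_dist H p q = \<rho> p q"
proof -
  interpret cut_tree_joining G S M by fact
  have H: "filling M \<rho> H" "total_weight H \<le> total_weight G"
    using min minimal_filling_of_generating_tree[OF G dist] unfolding minimal_filling_def by auto
  have "graph_dist H p q \<le> \<rho> p q"
    using filling_lower_bound[OF H(1) dist pq] H(2) by simp
  moreover have "\<rho> p q \<le> graph_dist H p q" using H(1) pq by (simp add: filling_def)
  ultimately show ?thesis by simp
qed

text \<open>
  A vertex of one tree has a counterpart at the same distances from \<open>M\<close> in every other tree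
  with the same metric on \<open>M\<close>: a point of \<open>M\<close> corresponds to itself, a median of three points
  of \<open>M\<close> to their median.
\<close>

lemma counterpart_exists:
  assumes "cut_tree_joining G S M" "cut_tree_joining H T M"
    and same: "\<And>p q. p \<in> M \<Longrightarrow> q \<in> M \<Longrightarrow> cut_tree.cut_dist G S p q = cut_tree.cut_dist H T p q"
    and v: "v \<in> verts G"
  shows "\<exists>v'\<in>verts H. \<forall>x\<in>M. cut_tree.cut_dist G S v x = cut_tree.cut_dist H T v' x"
proof -
  interpret G: cut_tree_joining G S M by fact
  interpret H: cut_tree_joining H T M by fact
  consider "M = {}" | "v \<in> M" | "M \<noteq> {}" "v \<notin> M" by blast
  then show ?thesis
  proof cases
    case 1
    then show ?thesis using H.M_empty by auto
  next
    case 2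
    then show ?thesis using same H.M_verts by blast
  next
    case 3
    obtain p q r where M: "p \<in> M" "q \<in> M" "r \<in> M"
      and med: "G.between p v q" "G.between p v r" "G.between q v r"
      using G.median_of_M[OF v 3(2,1)] .
    obtain v' where v': "v' \<in> verts H"
      and med': "H.between p v' q" "H.between p v' r" "H.between q v' r"
      using H.median_exists[of p q r] M H.M_verts by blast
    \<comment> \<open>The distances from a median to its three points are half-sums of the distances among them.\<close>
    note eqs = med[THEN G.cut_dist_between] med'[THEN H.cut_dist_between]
      same[OF M(1,2)] same[OF M(1,3)] same[OF M(2,3)]
      G.cut_dist_commute[of _ v] H.cut_dist_commute[of _ v']
    have legs: "G.cut_dist v p = H.cut_dist v' p" "G.cut_dist v q = H.cut_dist v' q"
      "G.cut_dist v r = H.cut_dist v' r"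
      using eqs(1-9) eqs(10)[of p] eqs(10)[of q] eqs(10)[of r]
        eqs(11)[of p] eqs(11)[of q] eqs(11)[of r] by linarith+
    have "G.cut_dist v x = H.cut_dist v' x" if x: "x \<in> M" for x
    proof -
      have "x \<in> verts G" "x \<in> verts H" using x G.M_verts H.M_verts by auto
      then show ?thesis
        using G.cut_dist_max_formula[OF v _ M med, of x] H.cut_dist_max_formula[OF v' _ M med', of x]
          legs same[OF x M(1)] same[OF x M(2)] same[OF x M(3)] by simp
    qed
    then show ?thesis using v' by blast
  qed
qed


section \<open>Non-degenerate trees are determined by their metric\<close>

locale nondegenerate_tree = cut_tree_joining +
  assumes nondeg: "nondegenerate G"
begin

lemma weight_pos: "e \<in> edges G \<Longrightarrow> 0 < weight G e"
  using nondeg by (simp add: nondegenerate_def)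

lemma cut_dist_pos:
  assumes "u \<in> verts G" "v \<in> verts G" "u \<noteq> v"
  shows "0 < cut_dist u v"
proof -
  obtain n where n: "{u, n} \<in> edges G" "S {u, n} u \<noteq> S {u, n} v"
    using first_edge[OF assms] .
  then show ?thesis
    unfolding cut_dist_def using finite_edges[OF weighted] weight_pos
    by (intro sum_pos2[of _ "{u, n}"]) (auto simp: less_imp_le)
qed

lemma cut_dist_eq_0: "u \<in> verts G \<Longrightarrow> v \<in> verts G \<Longrightarrow> cut_dist u v = 0 \<longleftrightarrow> u = v"
  using cut_dist_pos[of u v] by (cases "u = v") auto

lemma between_iff_cut_dist:
  "between x z y \<longleftrightarrow> cut_dist x y = cut_dist x z + cut_dist z y"
proof
  assume eq: "cut_dist x y = cut_dist x z + cut_dist z y"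
  show "between x z y"
    unfolding between_def
  proof (intro ballI impI, rule ccontr)
    fix e assume "e \<in> edges G" "S e x = S e y" "S e z \<noteq> S e x"
    then have "cut_dist x y < cut_dist x z + cut_dist z y"
      unfolding cut_dist_def sum.distrib[symmetric]
      using finite_edges[OF weighted] weight_pos
      by (intro sum_strict_mono_ex1 bexI[of _ e]) (auto simp: less_imp_le)
    then show False using eq by simp
  qed
qed (rule cut_dist_between)

text \<open>Edges are the pairs of distinct vertices with no third vertex between them.\<close>

lemma edge_iff_cut_dist:
  assumes V: "u \<in> verts G" "v \<in> verts G"
  shows "{u, v} \<in> edges G \<longleftrightarrow> u \<noteq> v \<and>
    (\<forall>w\<in>verts G. cut_dist u v = cut_dist u w + cut_dist w v \<longrightarrow> w = u \<or> w = v)"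
proof (intro iffI conjI ballI impI)
  assume e: "{u, v} \<in> edges G"
  show "u \<noteq> v" using edge_verts[OF weighted e] by simp
  fix w assume w: "w \<in> verts G" "cut_dist u v = cut_dist u w + cut_dist w v"
  have other: "S f u = S f v \<and> S f w = S f u" if "f \<in> edges G" "f \<noteq> {u, v}" for f
    using cut[OF that(1) e] that w(2) between_iff_cut_dist unfolding between_def by metis
  show "w = u \<or> w = v"
  proof (cases "S {u, v} w = S {u, v} u")
    case True
    then show ?thesis using other w(1) V by (metis vertex_eqI)
  next
    case False
    then have "S {u, v} w = S {u, v} v" using cut[OF e e] by auto
    then show ?thesis using other w(1) V by (metis vertex_eqI)
  qed
next
  assume R: "u \<noteq> v \<and>
    (\<forall>w\<in>verts G. cut_dist u v = cut_dist u w + cut_dist w v \<longrightarrow> w = u \<or> w = v)"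
  then obtain n where n: "{u, n} \<in> edges G" "S {u, n} u \<noteq> S {u, n} v"
    using first_edge[OF V] by blast
  have "between u n v"
    using edge_between[of n u u v] n V by (simp add: insert_commute)
  then have "n = u \<or> n = v"
    using R edge_verts[OF weighted n(1)] between_iff_cut_dist by blast
  then show "{u, v} \<in> edges G" using n(1) edge_verts[OF weighted n(1)] by auto
qed

text \<open>Prolonging the path from \<open>u\<close> to \<open>v\<close> expresses their distance through distances to \<open>M\<close>.\<close>

lemma cut_dist_via_M:
  assumes "u \<in> verts G" "v \<in> verts G"
  shows "u = v \<or> (\<exists>p\<in>M. cut_dist u v = cut_dist u p - cut_dist v p)"
proof (cases "u = v")
  case False
  then obtain p where "p \<in> M" "between u v p" using extend[OF assms] by blast
  then show ?thesis using cut_dist_between[of u v p] by (auto intro!: bexI[of _ p])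
qed simp

end

text \<open>
  Applied in both directions, this makes the correspondence between vertices with the same
  distances to \<open>M\<close> an isometry.
\<close>

lemma counterpart_dist_le:
  assumes "nondegenerate_tree G S M" "nondegenerate_tree H T M"
    and V: "u \<in> verts G" "v \<in> verts G"
    and eq: "\<And>x. x \<in> M \<Longrightarrow> cut_tree.cut_dist G S u x = cut_tree.cut_dist H T u' x"
      "\<And>x. x \<in> M \<Longrightarrow> cut_tree.cut_dist G S v x = cut_tree.cut_dist H T v' x"
  shows "cut_tree.cut_dist G S u v \<le> cut_tree.cut_dist H T u' v'"
proof -
  interpret G: nondegenerate_tree G S M by fact
  interpret H: nondegenerate_tree H T M by fact
  show ?thesis
    using G.cut_dist_via_M[OF V] H.cut_dist_triangle[of u' _ v'] H.cut_dist_nonneg eq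
    by (auto simp: diff_le_eq)
qed

lemma isomorphic_over_if_same_dist:
  assumes GH: "nondegenerate_tree G S M" "nondegenerate_tree H T M"
    and same: "\<And>p q. p \<in> M \<Longrightarrow> q \<in> M \<Longrightarrow> cut_tree.cut_dist G S p q = cut_tree.cut_dist H T p q"
  shows "isomorphic_over M G H"
proof -
  interpret G: nondegenerate_tree G S M by fact
  interpret H: nondegenerate_tree H T M by fact
  have "\<forall>v\<in>verts G. \<exists>v'\<in>verts H. \<forall>x\<in>M. G.cut_dist v x = H.cut_dist v' x"
    using counterpart_exists[OF G.cut_tree_joining_axioms H.cut_tree_joining_axioms same] by blast
  then obtain f where f: "\<And>v. v \<in> verts G \<Longrightarrow> f v \<in> verts H"
    and fM: "\<And>v x. v \<in> verts G \<Longrightarrow> x \<in> M \<Longrightarrow> G.cut_dist v x = H.cut_dist (f v) x"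
    by metis
  have iso: "G.cut_dist u v = H.cut_dist (f u) (f v)" if "u \<in> verts G" "v \<in> verts G" for u v
    using counterpart_dist_le[OF GH that, of "f u" "f v"]
      counterpart_dist_le[OF GH(2,1) f[OF that(1)] f[OF that(2)], of u v] fM that
    by (metis order_antisym)
  have inj: "inj_on f (verts G)"
    using iso G.cut_dist_eq_0 H.cut_dist_eq_0 f by (metis inj_onI)
  have surj: "\<exists>v\<in>verts G. f v = w" if w: "w \<in> verts H" for w
  proof -
    obtain v where v: "v \<in> verts G" "\<And>x. x \<in> M \<Longrightarrow> H.cut_dist w x = G.cut_dist v x"
      using counterpart_exists[OF H.cut_tree_joining_axioms G.cut_tree_joining_axioms
          same[symmetric] w] by blast
    have "H.cut_dist w (f v) \<le> G.cut_dist v v"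
      by (rule counterpart_dist_le[OF GH(2,1) w f[OF v(1)]]) (use v fM in auto)
    then have "H.cut_dist w (f v) = 0" using H.cut_dist_nonneg[of w "f v"] by simp
    then have "w = f v" using H.cut_dist_eq_0[OF w f[OF v(1)]] by simp
    then show ?thesis using v(1) by blast
  qed
  have im: "f ` verts G = verts H" using f surj by blast
  have edge: "{u, v} \<in> edges G \<longleftrightarrow> {f u, f v} \<in> edges H" if V: "u \<in> verts G" "v \<in> verts G" for u v
  proof -
    have "(\<forall>w\<in>verts H. H.cut_dist (f u) (f v) = H.cut_dist (f u) w + H.cut_dist w (f v) \<longrightarrow>
        w = f u \<or> w = f v) \<longleftrightarrow>
      (\<forall>w\<in>verts G. G.cut_dist u v = G.cut_dist u w + G.cut_dist w v \<longrightarrow> w = u \<or> w = v)"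
      unfolding im[symmetric] ball_simps
      using iso V inj by (intro ball_cong refl) (auto simp: inj_on_eq_iff)
    then show ?thesis
      using G.edge_iff_cut_dist[OF V] H.edge_iff_cut_dist[OF f[OF V(1)] f[OF V(2)]]
        inj V by (auto simp: inj_on_eq_iff)
  qed
  show ?thesis
    unfolding isomorphic_over_def
  proof (intro exI[of _ f] conjI ballI)
    show "bij_betw f (verts G) (verts H)" using inj im by (simp add: bij_betw_def)
    show "(\<lambda>e. f ` e) ` edges G = edges H"
    proof (rule subset_antisym)
      show "(\<lambda>e. f ` e) ` edges G \<subseteq> edges H"
      proof (rule image_subsetI)
        fix e assume e: "e \<in> edges G"
        obtain a b where ab: "e = {a, b}" "a \<in> verts G" "b \<in> verts G" "a \<noteq> b"
          using edgeE[OF G.weighted e] .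
        have "{f a, f b} \<in> edges H" using e[unfolded ab(1)] by (rule iffD1[OF edge[OF ab(2,3)]])
        then show "f ` e \<in> edges H" unfolding ab(1) image_insert image_empty .
      qed
      show "edges H \<subseteq> (\<lambda>e. f ` e) ` edges G"
      proof
        fix e assume e: "e \<in> edges H"
        obtain a b where ab: "e = {a, b}" "a \<in> verts H" "b \<in> verts H" "a \<noteq> b"
          using edgeE[OF H.weighted e] .
        obtain u v where uv: "u \<in> verts G" "v \<in> verts G" "f u = a" "f v = b"
          using surj[OF ab(2)] surj[OF ab(3)] by blast
        have "e = {f u, f v}" using ab(1) uv(3,4) by simp
        then have "{u, v} \<in> edges G" "e = f ` {u, v}" using e edge[OF uv(1,2)] by simp_all
        then show "e \<in> (\<lambda>e. f ` e) ` edges G" by (intro image_eqI)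
      qed
    qed
    fix e assume e: "e \<in> edges G"
    obtain a b where ab: "e = {a, b}" "a \<in> verts G" "b \<in> verts G" "a \<noteq> b"
      using edgeE[OF G.weighted e] .
    have "{f a, f b} \<in> edges H" using e[unfolded ab(1)] by (rule iffD1[OF edge[OF ab(2,3)]])
    then have "weight H {f a, f b} = weight G {a, b}"
      using G.cut_dist_edge[of a b] H.cut_dist_edge[of "f a" "f b"] iso[OF ab(2,3)] e ab(1) by simp
    then show "weight H (f ` e) = weight G e" by (simp add: ab(1))
  next
    fix p assume p: "p \<in> M"
    then have V: "p \<in> verts G" "p \<in> verts H" using G.M_verts H.M_verts by auto
    have "H.cut_dist (f p) p = 0" using fM[OF V(1) p] by simp
    then show "f p = p" using H.cut_dist_eq_0[OF f[OF V(1)] V(2)] by simp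
  qed
qed


section \<open>Contracting the edges of weight zero\<close>

text \<open>
  The vertices of the contracted tree represent the classes of vertices at distance zero. Each
  edge of positive weight keeps its weight and its bipartition, hence distances and betweenness
  are unchanged. For nonempty \<open>M\<close>, a vertex outside \<open>M\<close> is still a median of three points of \<open>M\<close>, all different
  from it, and therefore has degree at least three.
\<close>

lemma nondegenerate_contraction:
  assumes "cut_tree_joining G S M"
    and pos: "\<And>p q. p \<in> M \<Longrightarrow> q \<in> M \<Longrightarrow> p \<noteq> q \<Longrightarrow> 0 < cut_tree.cut_dist G S p q"
  shows "\<exists>H T. nondegenerate_tree H T M \<and>
    (\<forall>p\<in>M. \<forall>q\<in>M. cut_tree.cut_dist H T p q = cut_tree.cut_dist G S p q)"
proof -
  interpret G: cut_tree_joining G S M by fact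
  define E where "E = {e \<in> edges G. 0 < weight G e}"
  define eqv where "eqv u v \<longleftrightarrow> (\<forall>e\<in>E. S e u = S e v)" for u v
  \<comment> \<open>Each class is represented by its point of \<open>M\<close>, if it has one.\<close>
  define r where
    "r u = (SOME x. x \<in> verts G \<and> eqv u x \<and> (x \<in> M \<or> \<not> (\<exists>p\<in>M. eqv u p)))" for u
  have r_spec: "r u \<in> verts G \<and> eqv u (r u) \<and> (r u \<in> M \<or> \<not> (\<exists>p\<in>M. eqv u p))"
    if "u \<in> verts G" for u
  proof -
    have "\<exists>x. x \<in> verts G \<and> eqv u x \<and> (x \<in> M \<or> \<not> (\<exists>p\<in>M. eqv u p))"
    proof (cases "\<exists>p\<in>M. eqv u p")
      case True
      then show ?thesis using G.M_verts by blast
    next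
      case False
      then show ?thesis using that by (intro exI[of _ u]) (auto simp: eqv_def)
    qed
    then show ?thesis unfolding r_def by (rule someI_ex)
  qed
  have r_cong: "r u = r v" if "eqv u v" for u v
  proof -
    have "eqv u x \<longleftrightarrow> eqv v x" for x using that by (auto simp: eqv_def)
    then show ?thesis by (simp add: r_def)
  qed
  have S_r: "S e (r u) = S e u" if "e \<in> E" "u \<in> verts G" for e u
    using r_spec[OF that(2)] that(1) by (auto simp: eqv_def)
  have r_M: "r p = p" if p: "p \<in> M" for p
  proof -
    have V: "p \<in> verts G" using p G.M_verts by blast
    have "eqv p p" by (simp add: eqv_def)
    then have rp: "r p \<in> M" "eqv p (r p)" using r_spec[OF V] p by blast+
    have "G.cut_dist p (r p) = 0"
      unfolding G.cut_dist_def
    proof (intro sum.neutral ballI)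
      fix e assume e: "e \<in> edges G"
      show "weight G e * of_bool (S e p \<noteq> S e (r p)) = 0"
        using rp(2) e weight_nonneg[OF G.weighted e] by (cases "e \<in> E") (auto simp: eqv_def E_def)
    qed
    then show ?thesis using pos[OF p rp(1)] by (cases "p = r p") auto
  qed
  have EE: "e \<in> edges G" if "e \<in> E" for e using that by (simp add: E_def)
  have EV: "a \<in> verts G" "b \<in> verts G" if "{a, b} \<in> E" for a b
    using edge_verts[OF G.weighted EE[OF that]] by auto
  have E_cases: "\<exists>a b. e = {a, b}" if "e \<in> E" for e
    using edgeE[OF G.weighted EE[OF that]] by metis
  have S_r_cut: "S e (r c) \<noteq> S e (r d) \<longleftrightarrow> {c, d} = e" if "e \<in> E" "{c, d} \<in> E" for e c d
    using S_r[OF that(1)] EV[OF that(2)] G.cut[OF EE EE, OF that] by simp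
  have inj: "inj_on (image r) E"
  proof (rule inj_onI)
    fix e f assume e: "e \<in> E" and f: "f \<in> E" and eq: "r ` e = r ` f"
    obtain a b where a: "e = {a, b}" using E_cases[OF e] by blast
    obtain c d where c: "f = {c, d}" using E_cases[OF f] by blast
    have "{r a, r b} = {r c, r d}" using eq a c by simp
    moreover have "S e (r a) \<noteq> S e (r b)" using S_r_cut[of e a b] e a by simp
    ultimately have "S e (r c) \<noteq> S e (r d)" by (auto simp: doubleton_eq_iff)
    then show "e = f" using S_r_cut[of e c d] e f c by simp
  qed
  define H where "H = \<lparr>verts = r ` verts G, edges = image r ` E,
    weight = (\<lambda>X. weight G (inv_into E (image r) X))\<rparr>"
  define T where "T X = S (inv_into E (image r) X)" for X
  have H_sel: "verts H = r ` verts G" "edges H = image r ` E" by (simp_all add: H_def)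
  have T_r: "T (r ` e) = S e" and w_r: "weight H (r ` e) = weight G e" if "e \<in> E" for e
    using inj that by (simp_all add: T_def H_def)
  have H_sub: "verts H \<subseteq> verts G" using r_spec H_sel by auto
  have wH: "weighted_graph H"
    unfolding weighted_graph_def
  proof (intro conjI ballI subsetI)
    show "finite (verts H)" "verts H \<noteq> {}"
      using G.weighted by (auto simp: H_sel weighted_graph_def)
    fix X assume "X \<in> edges H"
    then obtain e where e: "e \<in> E" "X = r ` e" using H_sel by auto
    then show "0 \<le> weight H X" using w_r by (simp add: E_def)
    obtain a b where a: "e = {a, b}" using E_cases[OF e(1)] by blast
    have V: "a \<in> verts G" "b \<in> verts G" using EV[of a b] e(1) a by auto
    have "r a \<noteq> r b" using S_r_cut[of e a b] e(1) a by auto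
    then show "X \<in> {{u, v} |u v. u \<in> verts H \<and> v \<in> verts H \<and> u \<noteq> v}"
      using e(2) a V H_sel by auto
  qed
  have conn: "connected_graph H"
  proof (rule connected_graphI[OF wH])
    fix u' v' assume "u' \<in> verts H" "v' \<in> verts H"
    then obtain u v where uv: "u' = r u" "v' = r v" "u \<in> verts G" "v \<in> verts G"
      using H_sel by auto
    obtain xs where xs: "graph_path G u v xs"
      using G.connected uv unfolding connected_graph_def by blast
    let ?R = "\<lambda>x y. {x, y} \<in> edges H"
    have step: "?R\<^sup>*\<^sup>* (r x) (r y)" if xy: "{x, y} \<in> edges G" for x y
    proof (cases "{x, y} \<in> E")
      case True
      then have "r ` {x, y} \<in> edges H" unfolding H_sel by blast
      then show ?thesis by auto
    next
      case False
      have "eqv x y" unfolding eqv_def using G.cut[OF EE xy] False by metis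
      then show ?thesis using r_cong by simp
    qed
    have "?R\<^sup>*\<^sup>* (r (hd xs)) (r (last xs))"
      if "xs \<noteq> []" "successively (\<lambda>x y. {x, y} \<in> edges G) xs" for xs
      using that
    proof (induction xs rule: induct_list012)
      case (3 x y zs)
      then show ?case using step[of x y] by (auto intro: rtranclp_trans)
    qed auto
    then show "?R\<^sup>*\<^sup>* u' v'" using xs uv unfolding graph_path_def by blast
  qed
  interpret H: cut_tree H T
  proof (unfold_locales)
    fix e' x y assume "e' \<in> edges H" "{x, y} \<in> edges H"
    then obtain e f where ef: "e \<in> E" "e' = r ` e" "f \<in> E" "{x, y} = r ` f"
      unfolding H_sel by auto
    obtain c d where c: "f = {c, d}" using E_cases[OF ef(3)] by blast
    have "{x, y} = {r c, r d}" using ef(4) c by simp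
    then have "S e x \<noteq> S e y \<longleftrightarrow> S e (r c) \<noteq> S e (r d)" by (auto simp: doubleton_eq_iff)
    also have "\<dots> \<longleftrightarrow> f = e" using S_r_cut[of e c d] ef(1,3) c by simp
    also have "\<dots> \<longleftrightarrow> {x, y} = e'" using inj_on_eq_iff[OF inj ef(3,1)] ef(2,4) by simp
    finally show "T e' x \<noteq> T e' y \<longleftrightarrow> {x, y} = e'" using T_r[OF ef(1)] ef(2) by simp
  qed (fact wH conn)+
  have MH: "M \<subseteq> verts H"
    using r_M G.M_verts unfolding H_sel by (metis image_eqI subset_iff)
  have H_between: "H.between x z y" if "G.between x z y" for x z y
    using that T_r EE unfolding H.between_def G.between_def H_sel by auto
  have deg: "v \<in> M" if v: "v \<in> verts H" "vertex_degree H v \<in> {1, 2}" for v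
  proof (rule ccontr)
    assume vM: "v \<notin> M"
    have "M \<noteq> {}"
    proof
      assume "M = {}"
      then have "edges H = {}" using G.M_empty by (auto simp: H_sel E_def)
      then show False using v(2) by (simp add: vertex_degree_def)
    qed
    then obtain p q s where M: "p \<in> M" "q \<in> M" "s \<in> M"
      and med: "G.between p v q" "G.between p v s" "G.between q v s"
      using G.median_of_M[of v] v(1) vM H_sub by blast
    have branch: "\<exists>e. e \<in> edges H \<and> v \<in> e \<and> T e v \<noteq> T e x" if "x \<in> M" for x
      using H.first_edge[of v x] v(1) vM that MH by (metis insertI1 subset_iff)
    \<comment> \<open>The first edges of the paths from \<open>v\<close> to the three points are distinct.\<close>
    have ne: "e \<noteq> f" if "T e v \<noteq> T e x" "T f v \<noteq> T f y" "G.between x v y" "e \<in> edges H" for e f x y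
      using H_between[OF that(3)] that(1,2,4) unfolding H.between_def by metis
    obtain e1 where e1: "e1 \<in> edges H" "v \<in> e1" "T e1 v \<noteq> T e1 p" using branch[OF M(1)] by blast
    obtain e2 where e2: "e2 \<in> edges H" "v \<in> e2" "T e2 v \<noteq> T e2 q" using branch[OF M(2)] by blast
    obtain e3 where e3: "e3 \<in> edges H" "v \<in> e3" "T e3 v \<noteq> T e3 s" using branch[OF M(3)] by blast
    have "e1 \<noteq> e2" "e1 \<noteq> e3" "e2 \<noteq> e3"
      using ne[OF e1(3) e2(3) med(1) e1(1)] ne[OF e1(3) e3(3) med(2) e1(1)]
        ne[OF e2(3) e3(3) med(3) e2(1)] by auto
    then have "card {e1, e2, e3} = 3" by simp
    moreover have "card {e1, e2, e3} \<le> card {e \<in> edges H. v \<in> e}"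
      using e1 e2 e3 finite_edges[OF wH] by (intro card_mono) auto
    ultimately show False using v(2) by (auto simp: vertex_degree_def)
  qed
  have nondeg: "nondegenerate H"
    using w_r unfolding nondegenerate_def H_sel by (auto simp: E_def)
  have "nondegenerate_tree H T M"
    using MH deg nondeg by unfold_locales
  moreover have "H.cut_dist p q = G.cut_dist p q" for p q
  proof -
    have "H.cut_dist p q = (\<Sum>e\<in>E. weight G e * of_bool (S e p \<noteq> S e q))"
      unfolding H.cut_dist_def H_sel sum.reindex[OF inj]
      using T_r w_r by (intro sum.cong) simp_all
    also have "\<dots> = G.cut_dist p q"
      unfolding G.cut_dist_def
    proof (rule sum.mono_neutral_left)
      show "\<forall>e\<in>edges G - E. weight G e * of_bool (S e p \<noteq> S e q) = 0"
        using weight_nonneg[OF G.weighted] by (force simp: E_def)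
    qed (use finite_edges[OF G.weighted] EE in auto)
    finally show ?thesis .
  qed
  ultimately show ?thesis by blast
qed


section \<open>Rigidity of additive metrics\<close>

lemma tree_joining_iff_cut_tree_joining:
  "tree_joining G M \<longleftrightarrow> (\<exists>S. cut_tree_joining G S M)"
proof
  assume G: "tree_joining G M"
  then obtain S where "cut_tree G S"
    using acyclic_imp_cut_tree unfolding tree_joining_def joins_def by blast
  then interpret cut_tree G S .
  have "cut_tree_joining G S M"
    using G by unfold_locales (auto simp: tree_joining_def joins_def)
  then show "\<exists>S. cut_tree_joining G S M" by blast
next
  assume "\<exists>S. cut_tree_joining G S M"
  then obtain S where "cut_tree_joining G S M" by blast
  then interpret cut_tree_joining G S M .
  show "tree_joining G M"
    using weighted connected M_verts acyclic degree by (auto simp: tree_joining_def joins_def)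
qed

theorem corollary9p4:
  fixes M :: "'a::infinite set" and \<rho> :: "'a \<Rightarrow> 'a \<Rightarrow> real"
  assumes "finite M" and "Metric_space M \<rho>" and "additive_on M \<rho>"
  shows "boundary_rigid M \<rho>"
proof -
  interpret Metric_space M \<rho> by fact
  obtain G where G: "tree_joining G M" "\<And>p q. p \<in> M \<Longrightarrow> q \<in> M \<Longrightarrow> \<rho> p q = graph_dist G p q"
    using assms(3) unfolding additive_on_def by blast
  obtain S where S: "cut_tree_joining G S M"
    using G(1) tree_joining_iff_cut_tree_joining by blast
  interpret G: cut_tree_joining G S M by (fact S)
  have \<rho>_eq: "\<rho> p q = G.cut_dist p q" if "p \<in> M" "q \<in> M" for p q
    using G(2)[OF that] G.graph_dist_eq_cut_dist[of p q] G.M_verts that by auto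
  have "0 < G.cut_dist p q" if "p \<in> M" "q \<in> M" "p \<noteq> q" for p q
    using that \<rho>_eq mdist_pos_eq by metis
  then obtain H T where H: "nondegenerate_tree H T M"
    and HG: "\<And>p q. p \<in> M \<Longrightarrow> q \<in> M \<Longrightarrow> cut_tree.cut_dist H T p q = G.cut_dist p q"
    using nondegenerate_contraction[OF S] by blast
  interpret H: nondegenerate_tree H T M by (fact H)
  have "minimal_filling M \<rho> H"
    using minimal_filling_of_generating_tree[OF H.cut_tree_joining_axioms] \<rho>_eq HG by simp
  then have "nondegenerate_minimal_tree M \<rho> H"
    using H.nondeg tree_joining_iff_cut_tree_joining H.cut_tree_joining_axioms
    unfolding nondegenerate_minimal_tree_def by blast
  moreover have tree: "\<exists>T. nondegenerate_tree K T M \<and>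
      (\<forall>p\<in>M. \<forall>q\<in>M. cut_tree.cut_dist K T p q = \<rho> p q)"
    if K: "nondegenerate_minimal_tree M \<rho> K" for K
  proof -
    obtain T where T: "cut_tree_joining K T M"
      using K tree_joining_iff_cut_tree_joining unfolding nondegenerate_minimal_tree_def by blast
    interpret K: cut_tree_joining K T M by (fact T)
    have "nondegenerate_tree K T M"
      using K by unfold_locales (simp add: nondegenerate_minimal_tree_def)
    moreover have "K.cut_dist p q = \<rho> p q" if pq: "p \<in> M" "q \<in> M" for p q
    proof -
      have "graph_dist K p q = \<rho> p q"
        using minimal_filling_dist[OF S _ \<rho>_eq pq] K
        unfolding nondegenerate_minimal_tree_def by blast
      then show ?thesis using K.graph_dist_eq_cut_dist[of p q] K.M_verts pq by (simp add: subset_iff)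
    qed
    ultimately show ?thesis by blast
  qed
  have "isomorphic_over M K L"
    if KL: "nondegenerate_minimal_tree M \<rho> K" "nondegenerate_minimal_tree M \<rho> L" for K L
    using tree[OF KL(1)] tree[OF KL(2)] isomorphic_over_if_same_dist by metis
  moreover have "pseudo_metric_on M \<rho>"
    using triangle commute by (auto simp: pseudo_metric_on_def)
  ultimately show ?thesis
    using assms(1) unfolding boundary_rigid_def by blast
qed

end
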